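(* Suppose $\delta>0$ and $n>m>0$ are integers ($\delta$ real, $n,m$ integers). Then the rational function $$F(a)=\frac{(a+\delta m)_m}{(a+\delta n)_n}$$ is decreasing on $[1/2,\infty)$.
   Context: $(x)_k=\Gamma(x+k)/\Gamma(x)=x(x+1)\cdots(x+k-1)$ denotes the rising factorial. *)

theory Defs
  imports "HOL-Analysis.Analysis"
begin

end

theory Submission
  imports Defs
begin

text \<open>
  The logarithmic derivative of the quotient is
  \<open>S m - S n\<close>, where \<open>S n = (\<Sum>k<n. 1 / (a + \<delta> * n + k))\<close>, so it suffices that \<open>S\<close> is
  strictly increasing in \<open>n\<close> once \<open>a \<ge> 1/2\<close> (\<open>sum_inverse_strict_mono\<close>). Writing each summand as \<open>1/n\<close> times
  \<open>1 / (\<delta> + (a + k) / n)\<close> and the latter as an exponential integral gives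
  \<open>S n = \<integral> exp (-\<delta> s) \<phi>\<^sub>n(s) ds\<close> over \<open>s \<ge> 0\<close>, where
  \<open>\<phi>\<^sub>n(s)\<close> is the mean of \<open>exp (-(a + k) s / n)\<close> over \<open>k < n\<close>
  (\<open>sum_inverse_has_integral\<close>). Rescaling \<open>s\<close> by \<open>n\<close>
  has thereby moved all dependence on \<open>n\<close> into \<open>\<phi>\<^sub>n\<close>, and it suffices to compare the
  integrands pointwise (\<open>mean_exp_strict_mono\<close>).

  The mean is a geometric sum: with \<open>u = s / n\<close>,
  \<open>\<phi>\<^sub>n(s) = (1 - exp (-s)) / (s * (exp ((a - 1/2) u) * (sinh (u/2) / (u/2))))\<close>.
  For \<open>a \<ge> 1/2\<close> neither factor that involves \<open>u\<close> decreases with \<open>u\<close>, and the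
  second one strictly increases because \<open>sinh x / x\<close> does, while \<open>u\<close> decreases with \<open>n\<close>. The bound \<open>1/2\<close> is thus
  the value of \<open>a\<close> at which the exponential factor disappears.
\<close>

lemma sinh_less_mult_cosh:
  fixes x :: real
  assumes "0 < x"
  shows "sinh x < x * cosh x"
proof -
  have "(\<lambda>t. t * cosh t - sinh t) 0 < (\<lambda>t. t * cosh t - sinh t) x"
  proof (rule DERIV_pos_imp_increasing_open[OF assms])
    fix t :: real assume "0 < t"
    have "((\<lambda>t. t * cosh t - sinh t) has_real_derivative t * sinh t) (at t)"
      by (auto intro!: derivative_eq_intros)
    with \<open>0 < t\<close> show "\<exists>y. ((\<lambda>t. t * cosh t - sinh t) has_real_derivative y) (at t) \<and> 0 < y"
      by force
  qed (intro continuous_intros)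
  then show ?thesis by simp
qed

lemma sinh_over_self_strict_mono:
  "strict_mono_on {0<..} (\<lambda>x::real. sinh x / x)"
proof (rule monotone_onI)
  fix x y :: real
  assume "x \<in> {0<..}" "x < y"
  show "sinh x / x < sinh y / y"
  proof (rule DERIV_pos_imp_increasing[OF \<open>x < y\<close>])
    fix t assume "x \<le> t"
    with \<open>x \<in> {0<..}\<close> have t: "0 < t" by simp
    then have "((\<lambda>x. sinh x / x) has_real_derivative (t * cosh t - sinh t) / t\<^sup>2) (at t)"
      by (auto intro!: derivative_eq_intros simp: field_simps power2_eq_square)
    moreover have "0 < (t * cosh t - sinh t) / t\<^sup>2"
      using t sinh_less_mult_cosh[OF t] by simp
    ultimately show "\<exists>y. ((\<lambda>x. sinh x / x) has_real_derivative y) (at t) \<and> 0 < y"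
      by blast
  qed
qed

text \<open>Factoring \<open>exp (-u/2)\<close> out of the denominator \<open>1 - exp (-u)\<close> of the geometric sum
  produces the hyperbolic sine and shifts \<open>a\<close> to \<open>a - 1/2\<close>.\<close>

lemma mean_exp_closed_form:
  fixes a s :: real
  assumes "0 < n" "0 < s"
  shows "(\<Sum>k<n. exp (- ((a + real k) / real n * s))) / real n =
    (1 - exp (- s)) /
      (s * (exp ((a - 1/2) * (s / real n)) * (sinh (s / real n / 2) / (s / real n / 2))))"
proof -
  define u where "u = s / real n"
  have u: "0 < u" and s: "s = real n * u"
    using assms by (auto simp: u_def)
  have "exp (- ((a + real k) / real n * s)) = exp (- (a * u)) * exp (- u) ^ k" for k
    using assms
    by (simp add: s exp_of_nat_mult[symmetric] exp_add[symmetric] field_simps)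
  then have "(\<Sum>k<n. exp (- ((a + real k) / real n * s))) =
      exp (- (a * u)) * ((exp (- u) ^ n - 1) / (exp (- u) - 1))"
    using u by (simp add: sum_distrib_left[symmetric] geometric_sum)
  also have "exp (- u) ^ n = exp (- s)"
    by (simp add: s exp_of_nat_mult[symmetric])
  also have "exp (- (a * u)) * ((exp (- s) - 1) / (exp (- u) - 1)) =
      (1 - exp (- s)) / (exp (a * u) * (1 - exp (- u)))"
    using u by (simp add: exp_minus divide_simps) (simp add: algebra_simps)
  also have "exp (a * u) * (1 - exp (- u)) = 2 * exp ((a - 1/2) * u) * sinh (u / 2)"
    by (simp add: sinh_field_def algebra_simps exp_add[symmetric])
  finally show ?thesis
    using u assms by (simp add: u_def[symmetric]) (simp add: s field_simps)
qed

lemma mean_exp_strict_mono: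
  fixes a s :: real
  assumes "1/2 \<le> a" "0 < m" "m < n" "0 < s"
  shows "(\<Sum>k<m. exp (- ((a + real k) / real m * s))) / real m
       < (\<Sum>k<n. exp (- ((a + real k) / real n * s))) / real n"
proof -
  define q where "q u = exp ((a - 1/2) * u) * (sinh (u / 2) / (u / 2))" for u :: real
  have u: "0 < s / real n" "s / real n < s / real m"
    using assms by (auto intro!: divide_strict_left_mono)
  have q_pos: "0 < q u" if "0 < u" for u
    using that by (simp add: q_def)
  have "q (s / real n) < q (s / real m)"
    unfolding q_def
  proof (rule mult_le_less_imp_less)
    show "exp ((a - 1/2) * (s / real n)) \<le> exp ((a - 1/2) * (s / real m))"
      using u assms(1) by (simp only: exp_le_cancel_iff) (intro mult_left_mono; simp)
    show "sinh (s / real n / 2) / (s / real n / 2) < sinh (s / real m / 2) / (s / real m / 2)"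
      by (rule monotone_onD[OF sinh_over_self_strict_mono]) (use u assms in auto)
    show "0 \<le> sinh (s / real n / 2) / (s / real n / 2)"
      using u by (intro divide_nonneg_pos) auto
  qed auto
  then have "(1 - exp (- s)) / (s * q (s / real m)) < (1 - exp (- s)) / (s * q (s / real n))"
    using assms q_pos u by (intro divide_strict_left_mono mult_strict_left_mono mult_pos_pos) auto
  then show ?thesis
    using assms mean_exp_closed_form[of m s a] mean_exp_closed_form[of n s a]
    by (simp add: q_def)
qed

lemma sum_inverse_has_integral:
  fixes a \<delta> :: real
  assumes "0 < a" "0 < \<delta>" "0 < n"
  shows "((\<lambda>s. exp (- (\<delta> * s)) * ((\<Sum>k<n. exp (- ((a + real k) / real n * s))) / real n))
    has_integral (\<Sum>k<n. 1 / (a + \<delta> * real n + real k))) {0..}"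
proof -
  have "((\<lambda>s. exp (- (\<delta> + (a + real k) / real n) * s) / real n)
      has_integral 1 / (a + \<delta> * real n + real k)) {0..}" for k
  proof -
    have c: "0 < \<delta> + (a + real k) / real n"
      using assms by (intro add_pos_nonneg) auto
    have "1 / (\<delta> + (a + real k) / real n) / real n = 1 / (a + \<delta> * real n + real k)"
      using assms by (simp add: distrib_right add_divide_distrib add_ac)
    then show ?thesis
      using has_integral_divide[OF has_integral_exp_minus_to_infinity[OF c, of 0], of "real n"]
      by simp
  qed
  then have "((\<lambda>s. \<Sum>k<n. exp (- (\<delta> + (a + real k) / real n) * s) / real n)
    has_integral (\<Sum>k<n. 1 / (a + \<delta> * real n + real k))) {0..}"
    by (intro has_integral_sum) auto
  then show ?thesis
    by (rule has_integral_eq[rotated])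
      (simp add: sum_distrib_left sum_divide_distrib exp_add[symmetric] algebra_simps)
qed

text \<open>Strictness survives integration because \<open>J - I\<close> is at least the gap accumulated on the
  compact interval \<open>{0..1}\<close>, where the integrands are continuous and differ by a positive amount
  in the interior.\<close>

lemma has_integral_strict_mono_half_line:
  fixes f g :: "real \<Rightarrow> real"
  assumes "(f has_integral I) {0..}" "(g has_integral J) {0..}"
    and "continuous_on {0..1} f" "continuous_on {0..1} g"
    and le: "f 0 \<le> g 0" and less: "\<And>s. 0 < s \<Longrightarrow> f s < g s"
  shows "I < J"
proof -
  have "f integrable_on {0..1}" "g integrable_on {0..1}"
    using assms(3,4) by (auto intro: integrable_continuous_interval)
  moreover have "integral {0..1} f < integral {0..1} g"
    using assms(3,4) less by (intro integral_less_real) auto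
  moreover have "integral {0..1} (\<lambda>s. g s - f s) \<le> J - I"
  proof (rule has_integral_subset_le[of "{0..1}" "{0..}"])
    show "((\<lambda>s. g s - f s) has_integral J - I) {0..}"
      using assms(1,2) by (intro has_integral_diff)
    show "((\<lambda>s. g s - f s) has_integral integral {0..1} (\<lambda>s. g s - f s)) {0..1}"
      using calculation by (intro integrable_integral integrable_diff)
    show "\<forall>s\<in>{0..}. 0 \<le> g s - f s"
      using le less by (metis atLeast_iff diff_ge_0_iff_ge less_eq_real_def)
  qed auto
  ultimately show ?thesis
    by (simp add: integral_diff)
qed

lemma sum_inverse_strict_mono:
  fixes a \<delta> :: real
  assumes "1/2 \<le> a" "0 < \<delta>" "0 < m" "m < n"
  shows "(\<Sum>k<m. 1 / (a + \<delta> * real m + real k)) < (\<Sum>k<n. 1 / (a + \<delta> * real n + real k))"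
proof (rule has_integral_strict_mono_half_line[OF sum_inverse_has_integral sum_inverse_has_integral])
  fix s :: real assume "0 < s"
  then show "exp (- (\<delta> * s)) * ((\<Sum>k<m. exp (- ((a + real k) / real m * s))) / real m)
      < exp (- (\<delta> * s)) * ((\<Sum>k<n. exp (- ((a + real k) / real n * s))) / real n)"
    using assms by (intro mult_strict_left_mono mean_exp_strict_mono) auto
qed (use assms in \<open>auto intro!: continuous_intros\<close>)

lemma ln_pochhammer:
  fixes x :: real
  assumes "0 < x"
  shows "ln (pochhammer x n) = (\<Sum>k<n. ln (x + real k))"
  using assms by (simp add: pochhammer_prod atLeast0LessThan ln_prod add_pos_nonneg)

lemma DERIV_ln_pochhammer_shift:
  fixes a c :: real
  assumes "0 < a" "0 \<le> c"
  shows "((\<lambda>a. \<Sum>k<n. ln (a + c + real k)) has_real_derivative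
    (\<Sum>k<n. 1 / (a + c + real k))) (at a)"
proof (rule DERIV_sum)
  fix k
  have "0 < a + c + real k" using assms by linarith
  then show "((\<lambda>a. ln (a + c + real k)) has_real_derivative 1 / (a + c + real k)) (at a)"
    by (auto intro!: derivative_eq_intros)
qed

theorem corollary4p2:
  fixes \<delta> :: real and m n :: nat
  assumes "\<delta> > 0" and "0 < m" and "m < n"
  shows "strict_antimono_on {1/2..}
    (\<lambda>a::real. pochhammer (a + \<delta> * real m) m / pochhammer (a + \<delta> * real n) n)"
proof (rule monotone_onI)
  fix x y :: real
  assume x: "x \<in> {1/2..}" and "x < y"
  define L where "L a = (\<Sum>k<m. ln (a + \<delta> * real m + real k))
    - (\<Sum>k<n. ln (a + \<delta> * real n + real k))" for a
  have "L y < L x"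
  proof (rule DERIV_neg_imp_decreasing[OF \<open>x < y\<close>])
    fix a assume "x \<le> a"
    with x have a: "1/2 \<le> a" by simp
    have "(L has_real_derivative (\<Sum>k<m. 1 / (a + \<delta> * real m + real k))
        - (\<Sum>k<n. 1 / (a + \<delta> * real n + real k))) (at a)"
      unfolding L_def using a assms by (intro DERIV_diff DERIV_ln_pochhammer_shift) auto
    with sum_inverse_strict_mono[OF a assms]
    show "\<exists>d. (L has_real_derivative d) (at a) \<and> d < 0"
      by (meson diff_less_0_iff_less)
  qed
  moreover have "pochhammer (a + \<delta> * real m) m / pochhammer (a + \<delta> * real n) n = exp (L a)"
    if "x \<le> a" for a
  proof -
    have "0 < a + \<delta> * real m" "0 < a + \<delta> * real n"
      using that x assms by (auto intro!: add_pos_nonneg)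
    then show ?thesis
      by (simp add: L_def exp_diff pochhammer_pos flip: ln_pochhammer)
  qed
  ultimately show "pochhammer (y + \<delta> * real m) m / pochhammer (y + \<delta> * real n) n
      < pochhammer (x + \<delta> * real m) m / pochhammer (x + \<delta> * real n) n"
    using \<open>x < y\<close> by simp
qed

end
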